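(* Let $d>1$ be an integer and let $g:[0,\infty)\to\mathbb{R}$ be a continuous function with compact support contained in $[0,\pi]$. If for every $\theta\in(0,1)$ the function $t\mapsto g(\theta^{-1}t)$ is isotropic positive semi-definite on $\mathbb{S}^d$, then $g$ is isotropic positive semi-definite on $\mathbb{R}^d$.
   Context: For a metric space $(\Omega,\rho)$, a real function $g$ of the distance is called isotropic positive semi-definite on $\Omega$ if for every $N\in\mathbb{N}$ and every set of points $\{x_1,\dots,x_N\}\subset\Omega$, the symmetric matrix $\big(g(\rho(x_i,x_j))\big)_{i,j=1}^N$ is positive semi-definite, i.e. $\mathbf{c}^T\big(g(\rho(x_i,x_j))\big)\mathbf{c}\ge0$ for all $\mathbf{c}\in\mathbb{R}^N$. On $\mathbb{R}^d$ the metric is the Euclidean distance. On the unit sphere $\mathbb{S}^d=\{x\in\mathbb{R}^{d+1}:|x|=1\}$ the metric is the geodesic distance $\rho(x,y)=\arccos(x\cdot y)\in[0,\pi]$. *)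

theory Defs
  imports "HOL-Analysis.Analysis"
begin

text \<open>
  The points \<open>x 0, \<dots>, x (N - 1)\<close> are listed as a family and may repeat. This gives the same notion
  as pairwise distinct points, since the coefficients of coinciding points can be added up.
  Only the values of \<open>g\<close> on \<open>[0, \<infinity>)\<close> matter when \<open>\<rho>\<close> is a metric on \<open>\<Omega>\<close>.
\<close>
definition isotropic_psd :: "'a set \<Rightarrow> ('a \<Rightarrow> 'a \<Rightarrow> real) \<Rightarrow> (real \<Rightarrow> real) \<Rightarrow> bool" where
  "isotropic_psd \<Omega> \<rho> g \<longleftrightarrow>
    (\<forall>(N::nat) (x::nat \<Rightarrow> 'a). (\<forall>i<N. x i \<in> \<Omega>) \<longrightarrow>
      (\<forall>c::nat \<Rightarrow> real. (\<Sum>i<N. \<Sum>j<N. c i * g (\<rho> (x i) (x j)) * c j) \<ge> 0))"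

text \<open>The metric on the unit sphere; not meaningful for vectors that are not of norm 1.\<close>
definition geodesic_dist :: "'a::real_inner \<Rightarrow> 'a \<Rightarrow> real" where
  "geodesic_dist x y = arccos (x \<bullet> y)"

end

theory Submission
  imports Defs
begin

text \<open>
  Euclidean space is the blow-up limit of the sphere. The points \<open>x\<^sub>i\<close> of \<open>\<real>\<^sup>d\<close> are placed in the
  tangent space of the sphere at a point \<open>p\<close>, and the exponential map at \<open>p\<close> carries \<open>\<theta> x\<^sub>i\<close> to a point
  \<open>y\<^sub>i(\<theta>)\<close> of the sphere. As \<open>\<theta>\<close> tends to \<open>0\<close>, the rescaled geodesic distances
  \<open>\<theta>\<^sup>-\<^sup>1 \<rho>(y\<^sub>i(\<theta>), y\<^sub>j(\<theta>))\<close> tend to \<open>\<bar>x\<^sub>i - x\<^sub>j\<bar>\<close> (lemma \<open>geodesic_dist_sphere_exp_tendsto\<close>). Since \<open>g\<close> is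
  continuous, each quadratic form of the Euclidean kernel is a limit of quadratic forms of the
  kernels \<open>g(\<theta>\<^sup>-\<^sup>1 \<rho>)\<close> on the sphere. Those are nonnegative, and so is their limit.
\<close>

text \<open>The Riemannian exponential map of the unit sphere at \<open>p\<close>, for tangent vectors \<open>v\<close>.\<close>
definition sphere_exp :: "'a::real_inner \<Rightarrow> 'a \<Rightarrow> 'a" where
  "sphere_exp p v = cos (norm v) *\<^sub>R p + sin (norm v) *\<^sub>R sgn v"

lemma norm_sphere_exp:
  fixes p v :: "'a::real_inner"
  assumes "norm p = 1" "p \<bullet> v = 0"
  shows "norm (sphere_exp p v) = 1"
proof (cases "v = 0")
  case True
  then show ?thesis using assms by (simp add: sphere_exp_def)
next
  case False
  have "p \<bullet> p = 1" "sgn v \<bullet> sgn v = 1" "p \<bullet> sgn v = 0"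
    using assms False by (auto simp: dot_square_norm norm_sgn sgn_div_norm)
  then have "sphere_exp p v \<bullet> sphere_exp p v = (cos (norm v))\<^sup>2 + (sin (norm v))\<^sup>2"
    by (simp add: sphere_exp_def inner_add_left inner_add_right inner_commute power2_eq_square)
  then show ?thesis by (simp add: norm_eq_sqrt_inner)
qed

text \<open>The differential of the exponential map at the origin is the identity.\<close>
lemma sphere_exp_ray_tendsto:
  fixes p v :: "'a::real_inner"
  shows "((\<lambda>\<theta>. inverse \<theta> *\<^sub>R (sphere_exp p (\<theta> *\<^sub>R v) - p)) \<longlongrightarrow> v) (at_right 0)"
proof -
  have "((\<lambda>\<theta>. cos (\<theta> * norm v)) has_real_derivative 0) (at 0 within {0<..})"
    by (auto intro!: derivative_eq_intros)
  then have c: "((\<lambda>\<theta>. inverse \<theta> * (cos (\<theta> * norm v) - 1)) \<longlongrightarrow> 0) (at_right 0)"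
    by (simp add: has_field_derivative_iff divide_inverse mult.commute)
  have "((\<lambda>\<theta>. sin (\<theta> * norm v)) has_real_derivative norm v) (at 0 within {0<..})"
    by (auto intro!: derivative_eq_intros)
  then have s: "((\<lambda>\<theta>. inverse \<theta> * sin (\<theta> * norm v)) \<longlongrightarrow> norm v) (at_right 0)"
    by (simp add: has_field_derivative_iff divide_inverse mult.commute)
  have "((\<lambda>\<theta>. (inverse \<theta> * (cos (\<theta> * norm v) - 1)) *\<^sub>R p
           + (inverse \<theta> * sin (\<theta> * norm v)) *\<^sub>R sgn v) \<longlongrightarrow> 0 *\<^sub>R p + norm v *\<^sub>R sgn v) (at_right 0)"
    by (intro tendsto_intros c s)
  also have "0 *\<^sub>R p + norm v *\<^sub>R sgn v = v"
    by (cases "v = 0") (simp_all add: sgn_div_norm)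
  finally have "((\<lambda>\<theta>. (inverse \<theta> * (cos (\<theta> * norm v) - 1)) *\<^sub>R p
           + (inverse \<theta> * sin (\<theta> * norm v)) *\<^sub>R sgn v) \<longlongrightarrow> v) (at_right 0)" .
  moreover have "\<forall>\<^sub>F \<theta> in at_right 0. (inverse \<theta> * (cos (\<theta> * norm v) - 1)) *\<^sub>R p
           + (inverse \<theta> * sin (\<theta> * norm v)) *\<^sub>R sgn v
         = inverse \<theta> *\<^sub>R (sphere_exp p (\<theta> *\<^sub>R v) - p)"
    using eventually_at_right_less[of 0]
    by eventually_elim (simp add: sphere_exp_def sgn_scaleR algebra_simps)
  ultimately show ?thesis
    by (rule Lim_transform_eventually)
qed

text \<open>
  The chord under an arc of length \<open>t\<close> has length \<open>2 sin (t / 2)\<close>. Unlike \<open>arccos\<close> at \<open>1\<close>, the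
  inverse sine is differentiable at \<open>0\<close>, so this form suits nearby points.
\<close>
lemma geodesic_dist_chord:
  fixes x y :: "'a::real_inner"
  assumes "norm x = 1" "norm y = 1"
  shows "geodesic_dist x y = 2 * arcsin (dist x y / 2)"
proof -
  define t where "t = geodesic_dist x y"
  have "\<bar>x \<bullet> y\<bar> \<le> 1"
    using Cauchy_Schwarz_ineq2[of x y] assms by simp
  then have t: "0 \<le> t" "t \<le> pi" "cos t = x \<bullet> y"
    unfolding t_def geodesic_dist_def by (auto intro: arccos_lbound arccos_ubound cos_arccos)
  have "(dist x y)\<^sup>2 = 2 - 2 * (x \<bullet> y)"
    using assms by (simp add: dist_norm power2_norm_eq_inner inner_diff_left inner_diff_right
        inner_commute norm_eq_1)
  also have "\<dots> = (2 * sin (t / 2))\<^sup>2"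
    using cos_double_sin[of "t / 2"] t(3) by (simp add: power_mult_distrib)
  finally have "dist x y = 2 * sin (t / 2)"
    by (rule power2_eq_imp_eq) (use t in \<open>auto intro!: sin_ge_zero\<close>)
  then have "arcsin (dist x y / 2) = t / 2"
    using t by (simp add: arcsin_sin)
  then show ?thesis by (simp add: t_def)
qed

lemma geodesic_dist_sphere_exp_tendsto:
  fixes p v w :: "'a::real_inner"
  assumes "norm p = 1" "p \<bullet> v = 0" "p \<bullet> w = 0"
  shows "((\<lambda>\<theta>. inverse \<theta> * geodesic_dist (sphere_exp p (\<theta> *\<^sub>R v)) (sphere_exp p (\<theta> *\<^sub>R w)))
           \<longlongrightarrow> dist v w) (at_right 0)"
proof -
  define \<delta> where "\<delta> \<theta> = dist (sphere_exp p (\<theta> *\<^sub>R v)) (sphere_exp p (\<theta> *\<^sub>R w))" for \<theta>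
  have "((\<lambda>\<theta>. norm (inverse \<theta> *\<^sub>R (sphere_exp p (\<theta> *\<^sub>R v) - p)
            - inverse \<theta> *\<^sub>R (sphere_exp p (\<theta> *\<^sub>R w) - p))) \<longlongrightarrow> dist v w) (at_right 0)"
    unfolding dist_norm by (intro tendsto_intros sphere_exp_ray_tendsto)
  moreover have "\<forall>\<^sub>F \<theta> in at_right 0. norm (inverse \<theta> *\<^sub>R (sphere_exp p (\<theta> *\<^sub>R v) - p)
            - inverse \<theta> *\<^sub>R (sphere_exp p (\<theta> *\<^sub>R w) - p)) = \<delta> \<theta> / \<theta>"
    using eventually_at_right_less[of 0]
    by eventually_elim
      (simp add: \<delta>_def dist_norm divide_inverse mult.commute flip: scaleR_diff_right)
  ultimately have "((\<lambda>\<theta>. \<delta> \<theta> / \<theta>) \<longlongrightarrow> dist v w) (at_right 0)"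
    by (simp cong: tendsto_cong)
  then have \<delta>: "(\<delta> has_real_derivative dist v w) (at 0 within {0<..})"
    by (simp add: has_field_derivative_iff \<delta>_def)
  \<comment> \<open>Both endpoints start at \<open>p\<close>, so the chord \<open>\<delta>\<close> vanishes at \<open>0\<close>, where \<open>arcsin\<close> has slope \<open>1\<close>.\<close>
  have "\<delta> 0 = 0" by (simp add: \<delta>_def)
  then have "((\<lambda>\<theta>. 2 * arcsin (\<delta> \<theta> / 2)) has_real_derivative dist v w) (at 0 within {0<..})"
    by (auto intro!: derivative_eq_intros \<delta>)
  then have "((\<lambda>\<theta>. 2 * arcsin (\<delta> \<theta> / 2) / \<theta>) \<longlongrightarrow> dist v w) (at_right 0)"
    by (simp add: has_field_derivative_iff \<open>\<delta> 0 = 0\<close>)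
  moreover have "geodesic_dist (sphere_exp p (\<theta> *\<^sub>R v)) (sphere_exp p (\<theta> *\<^sub>R w))
      = 2 * arcsin (\<delta> \<theta> / 2)" for \<theta>
    unfolding \<delta>_def using assms by (intro geodesic_dist_chord norm_sphere_exp) auto
  ultimately show ?thesis
    by (simp only: divide_inverse_commute)
qed

text \<open>The tangent space of the unit sphere of \<open>\<real>\<^sup>d\<^sup>+\<^sup>1\<close> at any of its points is a copy of \<open>\<real>\<^sup>d\<close>.\<close>
lemma isometry_into_tangent_space:
  fixes p :: "'b::euclidean_space"
  assumes "DIM('b) = DIM('a) + 1" "p \<noteq> 0"
  obtains f :: "'a::euclidean_space \<Rightarrow> 'b"
  where "\<And>x. p \<bullet> f x = 0" "\<And>x y. dist (f x) (f y) = dist x y"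
proof -
  have "dim {v. p \<bullet> v = 0} = DIM('b) - 1"
    using assms(2) by (rule dim_hyperplane)
  then have "dim (UNIV :: 'a set) \<le> dim {v. p \<bullet> v = 0}"
    using assms(1) by simp
  then obtain f :: "'a \<Rightarrow> 'b" where f: "linear f" "f \<in> UNIV \<rightarrow> {v. p \<bullet> v = 0}"
      "\<And>x. x \<in> UNIV \<Longrightarrow> norm (f x) = norm x"
    using isometry_subset_subspace[OF subspace_UNIV subspace_hyperplane] by metis
  show ?thesis
  proof
    show "p \<bullet> f x = 0" for x using f(2) by auto
    show "dist (f x) (f y) = dist x y" for x y
      using f(1,3) by (simp add: dist_norm flip: linear_diff)
  qed
qed

theorem theorem1p7:
  fixes d :: nat and g :: "real \<Rightarrow> real"
  assumes "d > 1"
    and "CARD('n::finite) = d" and "CARD('m::finite) = d + 1"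
    and "continuous_on {0..} g"
    and "compact (closure (support_on {0..} g))"
    and "closure (support_on {0..} g) \<subseteq> {0..pi}"
    and "\<And>\<theta>::real. \<theta> \<in> {0<..<1} \<Longrightarrow>
           isotropic_psd (sphere (0::real^'m) 1) geodesic_dist (\<lambda>t. g (inverse \<theta> * t))"
  shows "isotropic_psd (UNIV :: (real^'n) set) dist g"
  unfolding isotropic_psd_def
proof (intro allI impI)
  fix N :: nat and x :: "nat \<Rightarrow> real^'n" and c :: "nat \<Rightarrow> real"
  obtain p :: "real^'m" where p: "norm p = 1"
    using vector_choose_size[of 1] by auto
  have "DIM(real^'m) = DIM(real^'n) + 1" "p \<noteq> 0"
    using assms(2,3) p by auto
  then obtain f :: "real^'n \<Rightarrow> real^'m"
    where tangent: "\<And>x. p \<bullet> f x = 0" and isometry: "\<And>x y. dist (f x) (f y) = dist x y"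
    using isometry_into_tangent_space by blast
  define y where "y \<theta> i = sphere_exp p (\<theta> *\<^sub>R f (x i))" for \<theta> i
  have y: "norm (y \<theta> i) = 1" for \<theta> i
    unfolding y_def using p tangent by (intro norm_sphere_exp) auto
  have "((\<lambda>\<theta>. g (inverse \<theta> * geodesic_dist (y \<theta> i) (y \<theta> j))) \<longlongrightarrow> g (dist (x i) (x j)))
          (at_right 0)" for i j
  proof (rule continuous_on_tendsto_compose[OF assms(4)])
    show "((\<lambda>\<theta>. inverse \<theta> * geodesic_dist (y \<theta> i) (y \<theta> j)) \<longlongrightarrow> dist (x i) (x j)) (at_right 0)"
      using geodesic_dist_sphere_exp_tendsto[OF p tangent tangent, of "x i" "x j"]
      by (simp add: y_def isometry)
    have nonneg: "0 \<le> geodesic_dist (y \<theta> i) (y \<theta> j)" for \<theta>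
      using Cauchy_Schwarz_ineq2[of "y \<theta> i" "y \<theta> j"] y
      by (auto simp: geodesic_dist_def intro!: arccos_lbound)
    show "\<forall>\<^sub>F \<theta> in at_right 0. inverse \<theta> * geodesic_dist (y \<theta> i) (y \<theta> j) \<in> {0..}"
      using eventually_at_right_less[of 0] by eventually_elim (simp add: nonneg)
  qed simp
  then have "((\<lambda>\<theta>. \<Sum>i<N. \<Sum>j<N. c i * g (inverse \<theta> * geodesic_dist (y \<theta> i) (y \<theta> j)) * c j)
      \<longlongrightarrow> (\<Sum>i<N. \<Sum>j<N. c i * g (dist (x i) (x j)) * c j)) (at_right 0)"
    by (intro tendsto_intros)
  moreover have "\<forall>\<^sub>F \<theta> in at_right 0.
      0 \<le> (\<Sum>i<N. \<Sum>j<N. c i * g (inverse \<theta> * geodesic_dist (y \<theta> i) (y \<theta> j)) * c j)"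
  proof -
    have "\<forall>\<^sub>F \<theta>::real in at_right 0. \<theta> \<in> {0<..<1}"
      by (rule eventually_at_right_real) simp
    then show ?thesis
    proof eventually_elim
      case (elim \<theta>)
      from assms(7)[OF this] y show ?case
        by (simp add: isotropic_psd_def)
    qed
  qed
  ultimately show "0 \<le> (\<Sum>i<N. \<Sum>j<N. c i * g (dist (x i) (x j)) * c j)"
    by (rule tendsto_lowerbound) simp
qed

end
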